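(* Let $G$ be a graph with maximum degree $\Delta$ and with $v_{\mathrm{odd}}$ vertices of odd degree. Then $E(G)$ can be odd-covered with at most $\Delta+\frac{v_{\mathrm{odd}}}{2}$ paths, i.e. $p_2(G)\le \Delta+\frac{v_{\mathrm{odd}}}{2}$.
   Context: All graphs are finite and simple. A path odd-cover of a graph $G=(V,E)$ is a collection of paths in the complete graph on $V$ whose edge sets have symmetric difference equal to $E$; $p_2(G)$ is its minimum cardinality. *)

theory Defs
  imports Complex_Main "Graph_Theory.Graph_Theory"
begin

text \<open>
  Finite simple graphs are the \<open>pair_graph\<close>s of the library: finite, loop-free, and
  symmetric, so that an undirected edge \<open>{u, v}\<close> is stored as the two arcs \<open>(u, v)\<close> and
  \<open>(v, u)\<close>. Consequently the degree of a vertex is its out-degree.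
\<close>

definition undirected_edges :: "('a \<times> 'a) set \<Rightarrow> 'a set set" where
  "undirected_edges A = (\<lambda>(u, v). {u, v}) ` A"

definition graph_edges :: "'a pair_pre_digraph \<Rightarrow> 'a set set" where
  "graph_edges G = undirected_edges (parcs G)"

abbreviation degree :: "'a pair_pre_digraph \<Rightarrow> 'a \<Rightarrow> nat" where
  "degree G v \<equiv> out_degree (with_proj G) v"

text \<open>Inserting \<open>0\<close> only matters for the graph without vertices, whose maximum degree is 0.\<close>

definition max_degree :: "'a pair_pre_digraph \<Rightarrow> nat" where
  "max_degree G = Max (insert 0 (degree G ` pverts G))"

definition v_odd :: "'a pair_pre_digraph \<Rightarrow> nat" where
  "v_odd G = card {v \<in> pverts G. odd (degree G v)}"

definition complete_graph_on :: "'a set \<Rightarrow> 'a pair_pre_digraph" where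
  "complete_graph_on V = \<lparr> pverts = V, parcs = {(u, v). u \<in> V \<and> v \<in> V \<and> u \<noteq> v} \<rparr>"

text \<open>A path is given by its list of vertices; this forgets the orientation.\<close>

definition path_edges :: "'a list \<Rightarrow> 'a set set" where
  "path_edges p = undirected_edges (set (vwalk_arcs p))"

text \<open>
  A collection of paths is a list, so repetitions are allowed and counted. The iterated
  symmetric difference does not depend on the order: it consists of the edges lying in an
  odd number of members.
\<close>

definition path_odd_cover :: "'a pair_pre_digraph \<Rightarrow> 'a list list \<Rightarrow> bool" where
  "path_odd_cover G Ps \<longleftrightarrow>
     (\<forall>p \<in> set Ps. vpath p (with_proj (complete_graph_on (pverts G)))) \<and>
     foldr sym_diff (map path_edges Ps) {} = graph_edges G"

definition p2 :: "'a pair_pre_digraph \<Rightarrow> nat" where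
  "p2 G = (LEAST k. \<exists>Ps. path_odd_cover G Ps \<and> length Ps = k)"

end

(* Peeling off a path between two odd vertices of the same component raises no degree
   and removes two odd vertices, so half as many paths as there are odd
   vertices leave an even subgraph of maximum degree at most Delta. Orient it with equal in- and
   out-degrees, at most k = Delta div 2. Such an orientation is a union of k permutations up to
   fixed points (Petersen's 2-factor argument, via Hall's theorem), and the disjoint cycles of a
   permutation are the symmetric difference of two paths: 2k further paths in all. *)

theory Submission
  imports Defs "HOL-Combinatorics.Cycles"
begin

section \<open>Hall's marriage theorem\<close>

text \<open>The exchange rate explains the bound: a permutation taken out of the orientation uses
  one outgoing and one incoming arc at each vertex that it moves, hence two units of degree, and it
  costs two paths. An odd \<Delta> costs nothing extra, as halving rounds down. Two obstacles shape
  the proof. The graph is not regular, so a permutation may fix a vertex, but only one whose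
  out-degree is below the current bound; otherwise the bound would not drop. And for a cycle of
  length two the closing edge is the only edge of the open path, so the two paths would cancel; an
  orientation never contains both arcs of an edge, which excludes such cycles. The paths joining odd
  vertices have to run inside the graph, since arbitrary ones could push degrees above \<Delta>. The
  later paths need the complete graph: their links between cycles need not be edges of
  \<open>G\<close>.\<close>

text \<open>Induction on \<open>card X\<close>, split by whether some nonempty proper subset is
  tight. A tight \<open>S\<close> is matched on its own and the rest avoids its neighbours; without
  a tight set any single pair can be matched first.\<close>

lemma hall_marriage:
  assumes "finite X"
    and "\<And>x. x \<in> X \<Longrightarrow> finite (N x)"
    and "\<And>S. S \<subseteq> X \<Longrightarrow> card S \<le> card (\<Union> (N ` S))"
  shows "\<exists>f. inj_on f X \<and> (\<forall>x\<in>X. f x \<in> N x)"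
  using assms
proof (induction "card X" arbitrary: X N rule: less_induct)
  case less
  note hall = less.prems(3)
  have finU: "finite (\<Union> (N ` S))" if "S \<subseteq> X" for S
    using that less.prems(1,2) finite_subset by blast
  show ?case
  proof (cases "\<exists>S. S \<subset> X \<and> S \<noteq> {} \<and> card (\<Union> (N ` S)) \<le> card S")
    case True
    then obtain S where S: "S \<subset> X" "S \<noteq> {}" "card (\<Union> (N ` S)) \<le> card S" by blast
    have finS: "finite S" using S(1) less.prems(1) finite_subset by blast
    have "\<exists>f. inj_on f S \<and> (\<forall>x\<in>S. f x \<in> N x)"
      using S(1) less.prems finS
      by (intro less.hyps) (auto intro: psubset_card_mono)
    then obtain f where f: "inj_on f S" "\<And>x. x \<in> S \<Longrightarrow> f x \<in> N x" by blast
    \<comment> \<open>Hall's condition survives: \<open>S \<union> T\<close> has at least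
      \<open>card S + card T\<close> neighbours, and tightness lets \<open>S\<close> take away at
      most \<open>card S\<close> of them.\<close>
    let ?M = "\<lambda>x. N x - \<Union> (N ` S)"
    have "\<exists>g. inj_on g (X - S) \<and> (\<forall>x\<in>X - S. g x \<in> ?M x)"
    proof (rule less.hyps)
      show "card (X - S) < card X"
        using S(1,2) less.prems(1) by (intro psubset_card_mono) auto
      show "card T \<le> card (\<Union> (?M ` T))" if T: "T \<subseteq> X - S" for T
      proof -
        have "card (S \<union> T) = card S + card T"
          using T finS less.prems(1) by (intro card_Un_disjoint) (auto intro: finite_subset)
        moreover have "card (S \<union> T) \<le> card (\<Union> (N ` (S \<union> T)))"
          using T S(1) by (intro hall) auto
        moreover have "card (\<Union> (N ` (S \<union> T))) - card (\<Union> (N ` S))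
            \<le> card (\<Union> (N ` (S \<union> T)) - \<Union> (N ` S))"
          using S(1) by (intro diff_card_le_card_Diff finU) auto
        ultimately have "card T \<le> card (\<Union> (N ` (S \<union> T)) - \<Union> (N ` S))"
          using S(3) by linarith
        also have "\<Union> (N ` (S \<union> T)) - \<Union> (N ` S) = \<Union> (?M ` T)" by auto
        finally show ?thesis .
      qed
    qed (use less.prems in auto)
    then obtain g where g: "inj_on g (X - S)" "\<And>x. x \<in> X - S \<Longrightarrow> g x \<in> ?M x" by blast
    let ?h = "\<lambda>x. if x \<in> S then f x else g x"
    have cross: "f x \<noteq> g y" if "x \<in> S" "y \<in> X - S" for x y
      using f(2)[OF that(1)] g(2)[OF that(2)] that by auto
    have "inj_on ?h X"
    proof (rule inj_onI)
      fix x y assume "x \<in> X" "y \<in> X" "?h x = ?h y"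
      then show "x = y"
        using f(1) g(1) cross[of x y] cross[of y x]
        by (auto simp: inj_on_def split: if_splits)
    qed
    moreover have "\<forall>x\<in>X. ?h x \<in> N x" using f(2) g(2) by auto
    ultimately show ?thesis by (intro exI[of _ ?h]) simp
  next
    case no_tight_set: False
    show ?thesis
    proof (cases "X = {}")
      case True
      then show ?thesis by simp
    next
      case False
      then obtain x where x: "x \<in> X" by blast
      have "card {x} \<le> card (\<Union> (N ` {x}))" using x by (intro hall) auto
      then have "N x \<noteq> {}" by auto
      then obtain y where y: "y \<in> N x" by blast
      \<comment> \<open>Nonempty proper subsets now have a surplus of at least one neighbour, which
        pays for the loss of \<open>y\<close>.\<close>
      let ?M = "\<lambda>z. N z - {y}"
      have "\<exists>g. inj_on g (X - {x}) \<and> (\<forall>z\<in>X - {x}. g z \<in> ?M z)"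
      proof (rule less.hyps)
        show "card (X - {x}) < card X"
          using x less.prems(1) by (intro psubset_card_mono) auto
        show "card T \<le> card (\<Union> (?M ` T))" if T: "T \<subseteq> X - {x}" for T
        proof (cases "T = {}")
          case False
          have "T \<subset> X" using T x by auto
          with False have "card T < card (\<Union> (N ` T))"
            using no_tight_set not_le_imp_less by blast
          moreover have "\<Union> (?M ` T) = \<Union> (N ` T) - {y}" by auto
          moreover have "card (\<Union> (N ` T)) - card {y} \<le> card (\<Union> (N ` T) - {y})"
            by (intro diff_card_le_card_Diff) auto
          ultimately show ?thesis by simp
        qed simp
      qed (use less.prems in auto)
      then obtain g where g: "inj_on g (X - {x})" "\<And>z. z \<in> X - {x} \<Longrightarrow> g z \<in> ?M z" by blast
      have "inj_on (g(x := y)) X"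
      proof (rule inj_onI)
        fix u v assume "u \<in> X" "v \<in> X" "(g(x := y)) u = (g(x := y)) v"
        then show "u = v"
          using g(1) g(2)[of u] g(2)[of v] by (auto simp: inj_on_def split: if_splits)
      qed
      moreover have "\<forall>z\<in>X. (g(x := y)) z \<in> N z" using g(2) y by auto
      ultimately show ?thesis by blast
    qed
  qed
qed

section \<open>Edge sets modulo two\<close>

definition edge_degree :: "'a set set \<Rightarrow> 'a \<Rightarrow> nat" where
  "edge_degree E v = card {e \<in> E. v \<in> e}"

text \<open>The boundary of an edge set modulo two. On finite sets it commutes with
  \<open>sym_diff\<close>, so parity bookkeeping becomes linear algebra.\<close>

definition odd_vertices :: "'a set set \<Rightarrow> 'a set" where
  "odd_vertices E = {v. odd (edge_degree E v)}"

lemma edge_degree_empty [simp]: "edge_degree {} v = 0"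
  by (simp add: edge_degree_def)

lemma edge_degree_mono: "finite F \<Longrightarrow> E \<subseteq> F \<Longrightarrow> edge_degree E v \<le> edge_degree F v"
  unfolding edge_degree_def by (intro card_mono) auto

lemma even_card_sym_diff:
  assumes "finite A" "finite B"
  shows "even (card (sym_diff A B)) \<longleftrightarrow> (even (card A) \<longleftrightarrow> even (card B))"
proof -
  have "card (sym_diff A B) = card (A - B) + card (B - A)"
    using assms by (intro card_Un_disjoint) auto
  moreover have "card A = card (A - B) + card (A \<inter> B)" 
    using assms by (subst card_Un_disjoint[symmetric]) (auto simp: Un_Diff_Int)
  moreover have "card B = card (B - A) + card (A \<inter> B)"
    using assms by (subst card_Un_disjoint[symmetric]) (auto intro: arg_cong[where f = card])
  ultimately show ?thesis by (simp only: even_add) blast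
qed

lemma odd_vertices_sym_diff:
  assumes "finite E" "finite F"
  shows "odd_vertices (sym_diff E F) = sym_diff (odd_vertices E) (odd_vertices F)"
proof -
  have "{e \<in> sym_diff E F. v \<in> e} = sym_diff {e \<in> E. v \<in> e} {e \<in> F. v \<in> e}" for v
    by auto
  then have "even (edge_degree (sym_diff E F) v)
      \<longleftrightarrow> (even (edge_degree E v) \<longleftrightarrow> even (edge_degree F v))" for v
    unfolding edge_degree_def using assms by (simp add: even_card_sym_diff)
  then show ?thesis by (auto simp: odd_vertices_def)
qed

lemma odd_vertices_empty [simp]: "odd_vertices {} = {}"
  by (simp add: odd_vertices_def)

lemma odd_vertices_single [simp]: "odd_vertices {e} = e"
proof -
  have "{e' \<in> {e}. v \<in> e'} = (if v \<in> e then {e} else {})" for v by auto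
  then show ?thesis by (auto simp: odd_vertices_def edge_degree_def)
qed

lemma odd_vertices_insert:
  assumes "finite E" "e \<notin> E"
  shows "odd_vertices (insert e E) = sym_diff e (odd_vertices E)"
proof -
  have "insert e E = sym_diff {e} E" using assms(2) by auto
  then show ?thesis using odd_vertices_sym_diff[of "{e}" E] assms(1) by simp
qed

text \<open>A new edge changes the odd set by a symmetric difference with a two-element set, which
  preserves the parity of its size.\<close>

lemma finite_odd_vertices_and_handshake:
  assumes "finite E" "\<And>e. e \<in> E \<Longrightarrow> card e = 2"
  shows "finite (odd_vertices E) \<and> even (card (odd_vertices E))"
  using assms
proof (induction E rule: finite_induct)
  case (insert e E)
  have "finite e" "card e = 2" using insert.prems[of e] by (auto intro: card_ge_0_finite)
  then show ?case
    using insert by (simp add: odd_vertices_insert even_card_sym_diff)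
qed simp

section \<open>Paths\<close>

definition is_path_in :: "'a set \<Rightarrow> 'a list \<Rightarrow> bool" where
  "is_path_in V p \<longleftrightarrow> p \<noteq> [] \<and> distinct p \<and> set p \<subseteq> V"

lemma set_vwalk_arcs_subset:
  "distinct p \<Longrightarrow> set p \<subseteq> V \<Longrightarrow> set (vwalk_arcs p) \<subseteq> {(u, v). u \<in> V \<and> v \<in> V \<and> u \<noteq> v}"
  by (induction p rule: vwalk_arcs.induct) auto

text \<open>Distinct consecutive vertices are always adjacent in a complete graph, so no adjacency
  condition remains. One-vertex paths are allowed and have no edges.\<close>

lemma vpath_complete_graph_on_iff:
  "vpath p (with_proj (complete_graph_on V)) \<longleftrightarrow> is_path_in V p"
  using set_vwalk_arcs_subset[of p V]
  by (auto simp: vpath_def vwalk_def is_path_in_def complete_graph_on_def)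

lemma path_edges_simps [simp]:
  "path_edges [] = {}"
  "path_edges [x] = {}"
  "path_edges (x # y # p) = insert {x, y} (path_edges (y # p))"
  by (simp_all add: path_edges_def undirected_edges_def)

lemma path_edges_append:
  "p \<noteq> [] \<Longrightarrow> q \<noteq> [] \<Longrightarrow>
    path_edges (p @ q) = insert {last p, hd q} (path_edges p \<union> path_edges q)"
  by (simp add: path_edges_def undirected_edges_def vwalk_arcs_append image_Un)

lemma finite_path_edges [simp]: "finite (path_edges p)"
  by (simp add: path_edges_def undirected_edges_def)

lemma path_edge_subset: "e \<in> path_edges p \<Longrightarrow> e \<subseteq> set p"
  by (induction p rule: vwalk_arcs.induct) auto

lemma set_subset_Union_path_edges: "2 \<le> length p \<Longrightarrow> set p \<subseteq> \<Union> (path_edges p)"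
proof (induction p rule: vwalk_arcs.induct)
  case (3 x y p)
  then show ?case by (cases p) auto
qed auto

lemma path_edge_nonempty: "e \<in> path_edges p \<Longrightarrow> e \<noteq> {}"
  by (induction p rule: vwalk_arcs.induct) auto

lemma odd_vertices_path_edges:
  "distinct p \<Longrightarrow> p \<noteq> [] \<Longrightarrow> hd p \<noteq> last p \<Longrightarrow> odd_vertices (path_edges p) = {hd p, last p}"
proof (induction p rule: vwalk_arcs.induct)
  case (3 x y p)
  have "{x, y} \<notin> path_edges (y # p)"
    using 3(2) path_edge_subset[of "{x, y}" "y # p"] by auto
  \<comment> \<open>Written as a symmetric difference so that a tail of one vertex, whose odd set is
    empty, is covered too.\<close>
  moreover have "odd_vertices (path_edges (y # p)) = sym_diff {y} {last (y # p)}"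
  proof (cases "p = []")
    case False
    then have "y \<noteq> last (y # p)" using 3(2) by auto
    then show ?thesis using 3 by auto
  qed simp
  ultimately have "odd_vertices (path_edges (x # y # p)) = sym_diff {x, y} (sym_diff {y} {last (y # p)})"
    by (simp add: odd_vertices_insert)
  also have "\<dots> = {x, last (y # p)}"
  proof -
    have "last (y # p) \<in> set (y # p)" by (intro last_in_set) simp
    then have "x \<noteq> y" "x \<noteq> last (y # p)" using 3(2) by auto
    then show ?thesis by blast
  qed
  finally show ?case by simp
qed auto

lemma path_between_reachable:
  assumes "(u, w) \<in> {(x, y). {x, y} \<in> E}\<^sup>*"
  shows "\<exists>p. p \<noteq> [] \<and> distinct p \<and> hd p = u \<and> last p = w \<and> path_edges p \<subseteq> E"
  using assms
proof (induction rule: rtrancl_induct)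
  case base
  show ?case by (rule exI[of _ "[u]"]) simp
next
  case (step y z)
  then obtain p where p: "p \<noteq> []" "distinct p" "hd p = u" "last p = y" "path_edges p \<subseteq> E"
    by blast
  show ?case
  proof (cases "z \<in> set p")
    case True
    \<comment> \<open>The walk returns to its own path: instead of extending it, cut it off at
      \<open>z\<close>.\<close>
    then obtain q r where qr: "p = q @ z # r" by (auto dest: split_list)
    have "path_edges (q @ [z]) \<subseteq> path_edges p"
    proof (cases r)
      case (Cons a r')
      then have "p = (q @ [z]) @ r" "r \<noteq> []" using qr by auto
      then show ?thesis using path_edges_append[of "q @ [z]" r] by auto
    qed (simp add: qr)
    then show ?thesis
      using p qr by (intro exI[of _ "q @ [z]"]) (auto simp: hd_append split: if_splits)
  next
    case False
    then show ?thesis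
      using p step.hyps(2) by (intro exI[of _ "p @ [z]"]) (auto simp: path_edges_append)
  qed
qed

text \<open>The handshake lemma, applied to the component of \<open>u\<close> alone, forces a second
  odd vertex within reach of \<open>u\<close>.\<close>

lemma path_between_odd_vertices:
  assumes "finite E" and two: "\<And>e. e \<in> E \<Longrightarrow> card e = 2" and u: "u \<in> odd_vertices E"
  shows "\<exists>p. p \<noteq> [] \<and> distinct p \<and> hd p \<noteq> last p \<and> hd p \<in> odd_vertices E \<and>
    last p \<in> odd_vertices E \<and> path_edges p \<subseteq> E"
proof -
  define C where "C = {w. (u, w) \<in> {(x, y). {x, y} \<in> E}\<^sup>*}"
  define F where "F = {e \<in> E. e \<subseteq> C}"
  have closed: "e \<subseteq> C" if "e \<in> E" "v \<in> e" "v \<in> C" for e v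
  proof
    fix w assume w: "w \<in> e"
    show "w \<in> C"
    proof (cases "w = v")
      case False
      have "card e = 2" using two that(1) by blast
      then have "e = {v, w}"
        using False w that(2) by (auto simp: card_2_iff)
      then show ?thesis
        using that(1,3) unfolding C_def by (auto intro: rtrancl_into_rtrancl)
    qed (use that in simp)
  qed
  have deg: "edge_degree F v = (if v \<in> C then edge_degree E v else 0)" for v
  proof -
    have "{e \<in> F. v \<in> e} = (if v \<in> C then {e \<in> E. v \<in> e} else {})"
      using closed unfolding F_def by auto
    then show ?thesis by (simp add: edge_degree_def)
  qed
  then have odd_F: "odd_vertices F = odd_vertices E \<inter> C"
    by (auto simp: odd_vertices_def split: if_splits)
  have uF: "u \<in> odd_vertices F" using u by (simp add: odd_F C_def)
  have "finite (odd_vertices F) \<and> even (card (odd_vertices F))"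
    using assms(1) two by (intro finite_odd_vertices_and_handshake) (auto simp: F_def)
  then have "odd_vertices F \<noteq> {u}" by auto
  then obtain w where w: "w \<in> odd_vertices E" "w \<in> C" "w \<noteq> u" using uF odd_F by blast
  then show ?thesis
    using path_between_reachable[of u w E] u unfolding C_def by fastforce
qed

lemma foldr_sym_diff_append:
  "foldr sym_diff (xs @ ys) {} = sym_diff (foldr sym_diff xs {}) (foldr sym_diff ys {})"
  by (induction xs) auto

text \<open>Each path lies inside the current edge set, so adding it modulo two is a deletion. This
  gives \<open>F \<subseteq> E\<close>, which later bounds the degrees of \<open>F\<close>; only the
  two ends of the path change parity.\<close>

lemma even_subgraph_modulo_paths:
  assumes "finite E" "\<And>e. e \<in> E \<Longrightarrow> card e = 2 \<and> e \<subseteq> V"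
  shows "\<exists>Ps F. F \<subseteq> E \<and> odd_vertices F = {} \<and> 2 * length Ps \<le> card (odd_vertices E) \<and>
    (\<forall>p\<in>set Ps. is_path_in V p) \<and> sym_diff (foldr sym_diff (map path_edges Ps) {}) F = E"
  using assms
proof (induction "card (odd_vertices E)" arbitrary: E rule: less_induct)
  case less
  show ?case
  proof (cases "odd_vertices E = {}")
    case True
    then show ?thesis by (intro exI[of _ "[]"] exI[of _ E]) simp
  next
    case False
    then obtain p where p: "p \<noteq> []" "distinct p" "hd p \<noteq> last p" "hd p \<in> odd_vertices E"
      "last p \<in> odd_vertices E" "path_edges p \<subseteq> E"
      using path_between_odd_vertices[OF less.prems(1)] less.prems(2) by blast
    define E' where "E' = E - path_edges p"
    have "E' = sym_diff E (path_edges p)" using p(6) by (auto simp: E'_def)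
    then have "odd_vertices E' = odd_vertices E - {hd p, last p}"
      using p odd_vertices_sym_diff[of E "path_edges p"] less.prems(1)
      by (auto simp: odd_vertices_path_edges)
    moreover have "finite (odd_vertices E)"
      using finite_odd_vertices_and_handshake less.prems by blast
    moreover have "card {hd p, last p} \<le> card (odd_vertices E)"
      using p \<open>finite (odd_vertices E)\<close> by (intro card_mono) auto
    ultimately have card: "card (odd_vertices E') + 2 = card (odd_vertices E)"
      using p by (simp add: card_Diff_subset)
    have "\<exists>Ps F. F \<subseteq> E' \<and> odd_vertices F = {} \<and> 2 * length Ps \<le> card (odd_vertices E') \<and>
      (\<forall>p\<in>set Ps. is_path_in V p) \<and> sym_diff (foldr sym_diff (map path_edges Ps) {}) F = E'"
      using card less.prems by (intro less.hyps) (auto simp: E'_def)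
    then obtain Ps F where IH: "F \<subseteq> E'" "odd_vertices F = {}"
      "2 * length Ps \<le> card (odd_vertices E')" "\<forall>p\<in>set Ps. is_path_in V p"
      "sym_diff (foldr sym_diff (map path_edges Ps) {}) F = E'" by blast
    have "set p \<subseteq> V"
    proof -
      have "length p \<ge> 2" using p(1,3) by (cases p rule: vwalk_arcs.cases) auto
      then show ?thesis using set_subset_Union_path_edges p(6) less.prems(2) by blast
    qed
    then have "is_path_in V p" using p by (simp add: is_path_in_def)
    moreover have "sym_diff (foldr sym_diff (map path_edges (p # Ps)) {}) F = E"
      using IH(5) p(6) unfolding E'_def by auto
    ultimately show ?thesis
      using IH card by (intro exI[of _ "p # Ps"] exI[of _ F]) (auto simp: E'_def)
  qed
qed

section \<open>Balanced orientations\<close>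

lemma undirected_edges_simps [simp]:
  "undirected_edges {} = {}"
  "undirected_edges (insert (x, y) A) = insert {x, y} (undirected_edges A)"
  "undirected_edges (A \<union> B) = undirected_edges A \<union> undirected_edges B"
  by (auto simp: undirected_edges_def)

lemma doubleton_in_undirected_edges:
  "{x, y} \<in> undirected_edges A \<longleftrightarrow> (x, y) \<in> A \<or> (y, x) \<in> A"
  by (force simp: undirected_edges_def doubleton_eq_iff)

lemma card_Image_insert:
  assumes "finite A" "(p, q) \<notin> A"
  shows "card (insert (p, q) A `` {x}) = card (A `` {x}) + of_bool (x = p)"
proof -
  have "insert (p, q) A `` {x} = (if x = p then insert q (A `` {x}) else A `` {x})" by auto
  then show ?thesis using assms by (auto simp: finite_Image)
qed

lemma card_converse_Image_insert:
  assumes "finite A" "(p, q) \<notin> A"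
  shows "card ((insert (p, q) A)\<inverse> `` {x}) = card (A\<inverse> `` {x}) + of_bool (x = q)"
proof -
  have "(insert (p, q) A)\<inverse> = insert (q, p) (A\<inverse>)" by auto
  then show ?thesis using card_Image_insert[of "A\<inverse>" q p x] assms by simp
qed

definition balanced :: "('a \<times> 'a) set \<Rightarrow> bool" where
  "balanced A \<longleftrightarrow> (\<forall>v. card (A `` {v}) = card (A\<inverse> `` {v}))"

text \<open>
  Splitting off: two edges \<open>va\<close>, \<open>vb\<close> are replaced by the edge \<open>ab\<close>, or deleted together
  with \<open>ab\<close> when that edge is already present. Either way the edge set changes by a triangle,
  so all degrees stay even, and an orientation of the smaller graph lifts back.
\<close>

lemma balanced_orientation:
  assumes "finite E" "\<And>e. e \<in> E \<Longrightarrow> card e = 2" "odd_vertices E = {}"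
  shows "\<exists>A. finite A \<and> asym A \<and> balanced A \<and> undirected_edges A = E"
  using assms
proof (induction "card E" arbitrary: E rule: less_induct)
  case less
  show ?case
  proof (cases "E = {}")
    case True
    then show ?thesis by (intro exI[of _ "{}"]) (auto simp: balanced_def asym_on_def)
  next
    case False
    then obtain e where e: "e \<in> E" by blast
    then obtain v a where va: "e = {v, a}" "v \<noteq> a"
      using less.prems(2) by (meson card_2_iff)
    \<comment> \<open>Even degree provides a second edge at \<open>v\<close>, to be split off
      together with \<open>e\<close>.\<close>
    have "even (card {f \<in> E. v \<in> f})"
      using less.prems(3) by (auto simp: odd_vertices_def edge_degree_def)
    then have "{f \<in> E. v \<in> f} \<noteq> {e}"
      by (metis is_singletonI is_singleton_altdef odd_one)
    then obtain f where f: "f \<in> E" "v \<in> f" "f \<noteq> e" using e va by blast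
    then obtain b where b: "f = {v, b}" "v \<noteq> b"
      using less.prems(2)[OF f(1)] by (auto simp: card_2_iff)
    have "a \<noteq> b" using f va b by auto
    have vaE: "{v, a} \<in> E" and vbE: "{v, b} \<in> E" using e f va b by auto
    have ne: "{v, a} \<noteq> {v, b}" "{v, a} \<noteq> {a, b}" "{v, b} \<noteq> {a, b}"
      using va b \<open>a \<noteq> b\<close> by (auto simp: doubleton_eq_iff)
    define T where "T = {{v, a}, {v, b}, {a, b}}"
    have "odd_vertices T = {}"
      using ne va b \<open>a \<noteq> b\<close> unfolding T_def by (simp add: odd_vertices_insert) blast
    define E' where "E' = sym_diff E T"
    have fin: "finite E'" using less.prems(1) by (simp add: E'_def T_def)
    have "odd_vertices E' = {}"
      using odd_vertices_sym_diff[of E T] less.prems(1,3) \<open>odd_vertices T = {}\<close>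
      by (simp add: E'_def T_def)
    moreover have "card e = 2" if "e \<in> E'" for e
    proof -
      have "e \<in> E \<or> e = {a, b}" using that vaE vbE unfolding E'_def T_def by blast
      then show ?thesis using less.prems(2) \<open>a \<noteq> b\<close> by auto
    qed
    moreover have "card E' < card E"
    proof -
      have "E' \<subseteq> insert {a, b} (E - {{v, a}, {v, b}})"
        using vaE vbE unfolding E'_def T_def by blast
      then have "card E' \<le> card (insert {a, b} (E - {{v, a}, {v, b}}))"
        using less.prems(1) by (intro card_mono) auto
      also have "\<dots> \<le> Suc (card (E - {{v, a}, {v, b}}))" by (simp add: card_insert_if less.prems(1))
      also have "card (E - {{v, a}, {v, b}}) = card E - 2"
        using vaE vbE ne by (subst card_Diff_subset) auto
      finally have "card E' \<le> Suc (card E - 2)" .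
      \<comment> \<open>Ensures that the truncated subtraction \<open>card E - 2\<close> really
        removes two edges.\<close>
      moreover have "card {{v, a}, {v, b}} \<le> card E"
        using vaE vbE less.prems(1) by (intro card_mono) auto
      ultimately show ?thesis using ne by simp
    qed
    ultimately obtain A' where A': "finite A'" "asym A'" "balanced A'" "undirected_edges A' = E'"
      using less.hyps[of E'] fin by blast
    have notin: "(x, y) \<notin> A'" "(y, x) \<notin> A'" if "{x, y} \<notin> E'" for x y
      using that A'(4) doubleton_in_undirected_edges by metis+
    have va': "{v, a} \<notin> E'" and vb': "{v, b} \<notin> E'"
      using vaE vbE by (auto simp: E'_def T_def)
    show ?thesis
    proof (cases "{a, b} \<in> E")
      case True
      then have ab': "{a, b} \<notin> E'" by (auto simp: E'_def T_def)
      \<comment> \<open>The deleted triangle is put back as a directed cycle, one arc in and one arc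
        out at each corner.\<close>
      define A where "A = insert (v, a) (insert (a, b) (insert (b, v) A'))"
      have new: "(b, v) \<notin> A'" "(a, b) \<notin> insert (b, v) A'"
        "(v, a) \<notin> insert (a, b) (insert (b, v) A')"
        using notin[OF va'] notin[OF vb'] notin[OF ab'] va b \<open>a \<noteq> b\<close> by auto
      have "balanced A"
        using A'(1,3) new unfolding balanced_def A_def
        by (simp add: card_Image_insert card_converse_Image_insert)
      moreover have "asym A"
        using A'(2) notin[OF va'] notin[OF vb'] notin[OF ab'] va b \<open>a \<noteq> b\<close>
        unfolding A_def asym_on_def by auto
      moreover have "undirected_edges A = E"
      proof -
        have "E' = E - T" using True vaE vbE by (auto simp: E'_def T_def)
        then have "E = T \<union> E'" using True vaE vbE by (auto simp: T_def)
        then show ?thesis using A'(4) by (auto simp: A_def T_def insert_commute)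
      qed
      ultimately show ?thesis using A'(1) by (intro exI[of _ A]) (simp add: A_def)
    next
      case False
      then have "{a, b} \<in> E'" by (simp add: E'_def T_def)
      then obtain c d where cd: "(c, d) \<in> A'" "{c, d} = {a, b}"
        using A'(4) doubleton_in_undirected_edges[of a b A'] by (metis insert_commute)
      have vc: "{v, c} \<notin> E'" and vd: "{v, d} \<notin> E'" and "c \<noteq> d" "v \<noteq> c" "v \<noteq> d"
        using cd(2) va' vb' va b \<open>a \<noteq> b\<close> by (auto simp: doubleton_eq_iff)
      define B where "B = A' - {(c, d)}"
      have AB: "A' = insert (c, d) B" "(c, d) \<notin> B" "finite B" using cd(1) A'(1) by (auto simp: B_def)
      \<comment> \<open>The arc standing for \<open>{a, b}\<close>, whichever way it points, is
        rerouted through \<open>v\<close>: nothing changes at \<open>c\<close> and \<open>d\<close>,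
        and \<open>v\<close> gains one arc in each direction.\<close>
      define A where "A = insert (c, v) (insert (v, d) B)"
      have new: "(v, d) \<notin> B" "(c, v) \<notin> insert (v, d) B"
        using notin[OF vc] notin[OF vd] \<open>v \<noteq> c\<close> by (auto simp: B_def)
      have "balanced A"
        unfolding balanced_def
      proof
        fix x
        have "card (A' `` {x}) = card (A'\<inverse> `` {x})" using A'(3) by (simp add: balanced_def)
        then show "card (A `` {x}) = card (A\<inverse> `` {x})"
          using new AB(2,3) unfolding AB(1) A_def
          by (simp add: card_Image_insert card_converse_Image_insert)
      qed
      moreover have "asym A"
        using A'(2) notin[OF vc] notin[OF vd] \<open>v \<noteq> c\<close> \<open>v \<noteq> d\<close> \<open>c \<noteq> d\<close>
        unfolding A_def B_def asym_on_def by auto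
      moreover have "undirected_edges A = E"
      proof -
        have "(d, c) \<notin> A'" using A'(2) cd(1) by (auto simp: asym_on_def)
        then have "{c, d} \<notin> undirected_edges B"
          by (simp add: doubleton_in_undirected_edges AB)
        moreover have "insert {c, d} (undirected_edges B) = E'" using A'(4) AB(1) by simp
        ultimately have "undirected_edges B = E' - {{a, b}}" using cd(2) by auto
        also have "\<dots> = E - {{v, a}, {v, b}}"
          using False vaE vbE by (auto simp: E'_def T_def)
        finally have "undirected_edges A = {{v, c}, {v, d}} \<union> (E - {{v, a}, {v, b}})"
          by (auto simp: A_def insert_commute)
        also have "{{v, c}, {v, d}} = {{v, a}, {v, b}}"
          using cd(2) by (auto simp: doubleton_eq_iff)
        finally show ?thesis using vaE vbE by auto
      qed
      ultimately show ?thesis using AB(3) by (intro exI[of _ A]) (simp add: A_def)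
    qed
  qed
qed

text \<open>Asymmetry keeps out- and in-neighbours apart, so no edge is counted twice. For a
  balanced orientation the degree is therefore twice the out-degree.\<close>

lemma edge_degree_undirected_edges:
  assumes "finite A" "asym A"
  shows "edge_degree (undirected_edges A) v = card (A `` {v}) + card (A\<inverse> `` {v})"
proof -
  have "{e \<in> undirected_edges A. v \<in> e} = (\<lambda>x. {v, x}) ` (A `` {v} \<union> A\<inverse> `` {v})"
    by (force simp: undirected_edges_def)
  moreover have "inj_on (\<lambda>x. {v, x}) S" for S by (auto simp: inj_on_def doubleton_eq_iff)
  moreover have "A `` {v} \<inter> A\<inverse> `` {v} = {}" using assms(2) by (auto simp: asym_on_def)
  ultimately show ?thesis
    using assms(1) by (simp add: edge_degree_def card_image card_Un_disjoint finite_Image)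
qed

section \<open>Disjoint cycles\<close>

text \<open>Applying the cycle to its own list rotates the list by one; zipping both yields the arcs
  of the open path, followed by the closing arc.\<close>

lemma arcs_of_cycle_of_list:
  assumes "distinct (x # cs)"
  shows "(\<lambda>v. (v, cycle_of_list (x # cs) v)) ` set (x # cs)
    = insert (last (x # cs), x) (set (vwalk_arcs (x # cs)))"
proof -
  let ?c = "cycle_of_list (x # cs)"
  have "map ?c (x # cs) = cs @ [x]"
    using cyclic_rotation[OF assms, of 1] by simp
  moreover have "map (\<lambda>v. (v, g v)) ys = zip ys (map g ys)" for g and ys :: "'a list"
    by (induction ys) auto
  ultimately have "map (\<lambda>v. (v, ?c v)) (x # cs) = zip (x # cs) (cs @ [x])"
    by metis
  also have "\<dots> = vwalk_arcs (x # cs) @ [(last (x # cs), x)]"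
  proof -
    have "zip (u # ys) (ys @ [w]) = vwalk_arcs (u # ys) @ [(last (u # ys), w)]"
      for u w and ys :: "'a list"
      by (induction ys arbitrary: u) auto
    then show ?thesis .
  qed
  finally have "set (map (\<lambda>v. (v, ?c v)) (x # cs)) = set (vwalk_arcs (x # cs) @ [(last (x # cs), x)])"
    by (rule arg_cong)
  then show ?thesis by (simp only: set_map set_append list.set Un_insert_right sup_bot_right)
qed

text \<open>Three vertices are needed: with two, the closing edge is the edge of the path.\<close>

lemma closing_edge_notin_path_edges:
  assumes "distinct (x # y # z # p)"
  shows "{x, last (z # p)} \<notin> path_edges (x # y # z # p)"
proof -
  have "last (z # p) \<in> set (z # p)" by (intro last_in_set) simp
  then have "last (z # p) \<noteq> y" "last (z # p) \<noteq> x" using assms by auto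
  moreover have "{x, last (z # p)} \<notin> path_edges (y # z # p)"
    using assms path_edge_subset[of _ "y # z # p"] by fastforce
  ultimately show ?thesis by (simp only: path_edges_simps(3)[of x]) (simp add: doubleton_eq_iff)
qed

text \<open>The second path is just the closing edge, or the single vertex of a trivial cycle. It
  shares both ends with \<open>cs\<close>, so that both paths can be linked to neighbouring cycles
  by the same edges.\<close>

lemma cycle_as_two_paths:
  assumes cs: "distinct cs" "cs \<noteq> []"
    and no2: "\<And>v. cycle_of_list cs (cycle_of_list cs v) = v \<Longrightarrow> cycle_of_list cs v = v"
  shows "\<exists>q. q \<noteq> [] \<and> distinct q \<and> set q \<subseteq> set cs \<and> hd q = hd cs \<and> last q = last cs \<and>
    undirected_edges {(v, cycle_of_list cs v) |v. cycle_of_list cs v \<noteq> v}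
      = sym_diff (path_edges cs) (path_edges q)"
proof (cases cs)
  case (Cons x cs')
  show ?thesis
  proof (cases cs')
    case Nil
    then show ?thesis using Cons by (intro exI[of _ "[x]"]) simp
  next
    case Cons': (Cons y ds)
    show ?thesis
    proof (cases ds)
      case Nil
      then show ?thesis using no2[of x] cs Cons Cons' by simp
    next
      case Cons'': (Cons z es)
      let ?c = "cycle_of_list cs"
      have cs_eq: "cs = x # y # z # es" using Cons Cons' Cons'' by simp
      have "last (z # es) \<in> set (z # es)" by (intro last_in_set) simp
      then have last: "last cs \<noteq> x" "last cs \<in> set cs" using cs(1) cs_eq by auto
      have arcs: "(\<lambda>v. (v, ?c v)) ` set cs = insert (last cs, x) (set (vwalk_arcs cs))"
        using arcs_of_cycle_of_list[of x cs'] cs(1) Cons by simp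
      have "?c v \<noteq> v" if "v \<in> set cs" for v
      proof -
        have "(v, ?c v) \<in> insert (last cs, x) (set (vwalk_arcs cs))"
          unfolding arcs[symmetric] using that by (rule imageI)
        then show ?thesis
          using set_vwalk_arcs_subset[OF cs(1) subset_refl] last(1) by auto
      qed
      then have "{(v, ?c v) |v. ?c v \<noteq> v} = (\<lambda>v. (v, ?c v)) ` set cs"
        using id_outside_supp[of _ cs] by blast
      then have "undirected_edges {(v, ?c v) |v. ?c v \<noteq> v} = insert {x, last cs} (path_edges cs)"
        using arcs by (simp add: path_edges_def insert_commute)
      moreover have "{x, last cs} \<notin> path_edges cs"
        using closing_edge_notin_path_edges[of x y z es] cs(1) cs_eq by simp
      moreover have "path_edges [x, last cs] = {{x, last cs}}" by simp
      ultimately have "undirected_edges {(v, ?c v) |v. ?c v \<noteq> v}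
          = sym_diff (path_edges cs) (path_edges [x, last cs])"
        by (simp add: insert_Diff_if)
      then show ?thesis
        using last cs_eq by (intro exI[of _ "[x, last cs]"]) auto
    qed
  qed
qed (use cs in simp)

text \<open>Here \<open>x\<close> is the linking edge: it occurs in both paths and cancels, while
  the parts on either side of it do not interact.\<close>

lemma sym_diff_insert_Un:
  assumes "x \<notin> A \<union> B" "x \<notin> C \<union> D" "(A \<union> B) \<inter> (C \<union> D) = {}"
  shows "sym_diff (insert x (A \<union> C)) (insert x (B \<union> D)) = sym_diff A B \<union> sym_diff C D"
  using assms by auto

lemma cycle_decomp_permutes: "cycle_decomp I p \<Longrightarrow> p permutes I"
proof (induction rule: cycle_decomp.induct)
  case (comp I p cs)
  have "p permutes (set cs \<union> I)" using comp.IH by (rule permutes_subset) simp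
  moreover have "cycle_of_list cs permutes (set cs \<union> I)"
    using cycle_permutes by (rule permutes_subset) simp
  ultimately show ?case by (rule permutes_compose)
qed (rule permutes_id)

text \<open>
  One path runs through each cycle in turn, leaving out its closing edge; the other one
  consists of the closing edges. Both use the same edges to move from one cycle to the next,
  and these cancel.
\<close>

lemma permutation_as_two_paths:
  assumes "cycle_decomp I s" "\<And>v. s (s v) = v \<Longrightarrow> s v = v" "I \<noteq> {}"
  shows "\<exists>p q. is_path_in I p \<and> is_path_in I q \<and> hd p = hd q \<and>
    undirected_edges {(v, s v) |v. s v \<noteq> v} = sym_diff (path_edges p) (path_edges q)"
  using assms
proof (induction rule: cycle_decomp.induct)
  case (comp I s cs)
  let ?c = "cycle_of_list cs"
  have s: "s permutes I" using comp.hyps(1) by (rule cycle_decomp_permutes)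
  have c: "?c permutes (set cs)" by (rule cycle_permutes)
  have on_cs: "(?c \<circ> s) v = ?c v" "s v = v" if "v \<notin> I" for v
    using that permutes_not_in[OF s] by auto
  have on_I: "(?c \<circ> s) v = s v" "?c v = v" if "v \<notin> set cs" for v
    using that comp.hyps(3) permutes_not_in[OF c] permutes_not_in[OF s] permutes_in_image[OF s, of v]
    by (metis comp_apply disjoint_iff)+
  have s_in: "s v \<notin> set cs" if "v \<notin> set cs" "v \<in> I" for v
    using that comp.hyps(3) permutes_in_image[OF s, of v] by blast
  have c_in: "?c v \<in> set cs" if "v \<in> set cs" for v
    using that permutes_in_image[OF c, of v] by blast
  \<comment> \<open>The supports are disjoint, so a 2-cycle of either factor would be one of the
    composition.\<close>
  have no2_s: "s v = v" if "s (s v) = v" for v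
  proof (cases "v \<in> I")
    case True
    then have "v \<notin> set cs" using comp.hyps(3) by blast
    then show ?thesis using comp.prems(1)[of v] that on_I s_in True by metis
  qed (rule on_cs(2))
  have no2_c: "?c v = v" if "?c (?c v) = v" for v
  proof (cases "v \<in> set cs")
    case True
    then have "v \<notin> I" "?c v \<notin> I" using comp.hyps(3) c_in by blast+
    then show ?thesis using comp.prems(1)[of v] that on_cs(1) by metis
  qed (rule on_I(2))
  have arcs: "{(v, (?c \<circ> s) v) |v. (?c \<circ> s) v \<noteq> v}
      = {(v, ?c v) |v. ?c v \<noteq> v} \<union> {(v, s v) |v. s v \<noteq> v}" (is "?L = ?C \<union> ?S")
  proof -
    have "v \<notin> I \<or> v \<notin> set cs" for v using comp.hyps(3) by blast
    then have "(v, w) \<in> ?L \<longleftrightarrow> (v, w) \<in> ?C \<union> ?S" for v w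
      using on_cs[of v] on_I[of v] by (cases "v \<in> I"; cases "v \<in> set cs") auto
    then show ?thesis by auto
  qed
  show ?case
  proof (cases "cs = []")
    case True
    then show ?thesis using comp.IH[OF no2_s] comp.prems(2) by simp
  next
    case False
    then obtain r where r: "r \<noteq> []" "distinct r" "set r \<subseteq> set cs" "hd r = hd cs" "last r = last cs"
      "undirected_edges ?C = sym_diff (path_edges cs) (path_edges r)"
      using cycle_as_two_paths[OF comp.hyps(2) _ no2_c] by blast
    show ?thesis
    proof (cases "I = {}")
      case True
      then have "?S = {}" using on_cs(2) by auto
      then show ?thesis
        using r False comp.hyps(2) True arcs
        by (intro exI[of _ cs] exI[of _ r]) (simp add: is_path_in_def)
    next
      case I: False
      obtain p q where pq: "is_path_in I p" "is_path_in I q" "hd p = hd q"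
        "undirected_edges ?S = sym_diff (path_edges p) (path_edges q)"
        using comp.IH[OF no2_s I] by blast
      have ne: "p \<noteq> []" "q \<noteq> []" and sub: "set p \<subseteq> I" "set q \<subseteq> I"
        using pq by (auto simp: is_path_in_def)
      \<comment> \<open>Since \<open>last r = last cs\<close> and \<open>hd p = hd q\<close>, both
        concatenations insert this same edge. This is why the induction carries
        \<open>hd p = hd q\<close>.\<close>
      let ?f = "{last cs, hd p}"
      have f: "last cs \<in> set cs" "last cs \<notin> I" "hd p \<in> I" "hd p \<notin> set cs"
        using False hd_in_set[OF ne(1)] sub comp.hyps(3) by (auto simp: disjoint_iff)
      have in_cs: "e \<subseteq> set cs \<and> e \<noteq> {}" if "e \<in> path_edges cs \<union> path_edges r" for e
        using that path_edge_subset path_edge_nonempty r(3) by fast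
      have in_I: "e \<subseteq> I \<and> e \<noteq> {}" if "e \<in> path_edges p \<union> path_edges q" for e
        using that path_edge_subset path_edge_nonempty sub by fast
      have f_new: "?f \<notin> path_edges cs \<union> path_edges r" "?f \<notin> path_edges p \<union> path_edges q"
        using in_cs[of ?f] in_I[of ?f] f by auto
      have disj: "(path_edges cs \<union> path_edges r) \<inter> (path_edges p \<union> path_edges q) = {}"
        using in_cs in_I comp.hyps(3) by blast
      have "path_edges (cs @ p) = insert ?f (path_edges cs \<union> path_edges p)"
        using False ne by (simp add: path_edges_append)
      moreover have "path_edges (r @ q) = insert ?f (path_edges r \<union> path_edges q)"
        using r ne pq(3) by (simp add: path_edges_append)
      ultimately have "sym_diff (path_edges (cs @ p)) (path_edges (r @ q))
        = sym_diff (path_edges cs) (path_edges r) \<union> sym_diff (path_edges p) (path_edges q)"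
        using sym_diff_insert_Un[OF f_new disj] by simp
      then have "undirected_edges ?L = sym_diff (path_edges (cs @ p)) (path_edges (r @ q))"
        using r(6) pq(4) arcs by simp
      moreover have "is_path_in (set cs \<union> I) (cs @ p)" "is_path_in (set cs \<union> I) (r @ q)"
        using pq(1,2) comp.hyps(2,3) r(1-3) False by (auto simp: is_path_in_def)
      moreover have "hd (cs @ p) = hd (r @ q)" using r False by simp
      ultimately show ?thesis by blast
    qed
  qed
qed simp

section \<open>Decomposition into permutations\<close>

text \<open>
  The relation obtained by adding to every vertex of out-degree less than \<open>m\<close> the missing number
  of loops is \<open>m\<close>-regular, which yields Hall's condition.
\<close>

lemma permutation_within_balanced:
  assumes fin: "finite V" and A: "A \<subseteq> V \<times> V" "balanced A"
    and le: "\<And>v. card (A `` {v}) \<le> m" and m: "m > 0"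
  shows "\<exists>s. s permutes V \<and> (\<forall>v\<in>V. (v, s v) \<in> A \<or> s v = v \<and> card (A `` {v}) < m)"
proof -
  let ?d = "\<lambda>v. card (A `` {v})"
  define N where "N v = A `` {v} \<union> (if ?d v < m then {v} else {})" for v
  have finA: "finite A" using fin A(1) finite_subset by blast
  have NV: "N v \<subseteq> V" if "v \<in> V" for v using that A(1) by (auto simp: N_def)
  have "card S \<le> card (\<Union> (N ` S))" if S: "S \<subseteq> V" for S
  proof -
    define T where "T = \<Union> (N ` S)"
    have finS: "finite S" and finT: "finite T"
      using S NV fin unfolding T_def by (auto intro: finite_subset)
    \<comment> \<open>Double counting: every arc leaving \<open>S\<close> enters \<open>T\<close>,
      and by balance the in-degrees of \<open>T\<close> may be replaced by its out-degrees.\<close>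
    have "(\<Sum>v\<in>S. ?d v) = card (SIGMA v:S. A `` {v})"
      using finS finA by (intro card_SigmaI[symmetric]) (auto simp: finite_Image)
    also have "\<dots> = card ((\<lambda>(x, y). (y, x)) ` (SIGMA v:S. A `` {v}))"
      by (intro card_image[symmetric]) (auto simp: inj_on_def)
    also have "\<dots> \<le> card (SIGMA y:T. A\<inverse> `` {y})"
      using finT finA by (intro card_mono finite_SigmaI) (auto simp: finite_Image T_def N_def)
    also have "\<dots> = (\<Sum>y\<in>T. card (A\<inverse> `` {y}))"
      using finT finA by (intro card_SigmaI) (auto simp: finite_Image)
    also have "\<dots> = (\<Sum>y\<in>T. ?d y)" using A(2) by (simp add: balanced_def)
    finally have arcs: "(\<Sum>v\<in>S. ?d v) \<le> (\<Sum>y\<in>T. ?d y)" .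
    \<comment> \<open>A vertex of \<open>S\<close> outside \<open>T\<close> has no loop, so its
      deficit is zero. Arcs and loops together count \<open>m\<close> per vertex.\<close>
    have "(\<Sum>v\<in>S. m - ?d v) = (\<Sum>v\<in>S \<inter> T. m - ?d v)"
      using finS by (intro sum.mono_neutral_right) (auto simp: T_def N_def split: if_splits)
    also have "\<dots> \<le> (\<Sum>y\<in>T. m - ?d y)" using finT by (intro sum_mono2) auto
    finally have loops: "(\<Sum>v\<in>S. m - ?d v) \<le> (\<Sum>y\<in>T. m - ?d y)" .
    have total: "(\<Sum>v\<in>X. ?d v) + (\<Sum>v\<in>X. m - ?d v) = card X * m" for X
      using le by (simp add: sum.distrib[symmetric])
    have "card S * m \<le> card T * m"
      using add_mono[OF arcs loops] by (simp add: total)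
    then show ?thesis using m by (simp add: T_def)
  qed
  then obtain f where f: "inj_on f V" "\<And>v. v \<in> V \<Longrightarrow> f v \<in> N v"
    using hall_marriage[of V N] fin NV by (meson finite_subset)
  have "f ` V = V" using f NV fin by (intro endo_inj_surj) auto
  then have "bij_betw f V V" using f(1) by (simp add: bij_betw_def)
  then have "(\<lambda>v. if v \<in> V then f v else v) permutes V"
    by (intro bij_imp_permutes) (auto simp: bij_betw_def inj_on_def)
  moreover have "(v, f v) \<in> A \<or> f v = v \<and> ?d v < m" if "v \<in> V" for v
    using f(2)[OF that] by (auto simp: N_def split: if_splits)
  ultimately show ?thesis by (intro exI[of _ "\<lambda>v. if v \<in> V then f v else v"]) simp
qed

text \<open>Each round deletes the arcs of one permutation, which keeps the orientation balanced and
  lowers the bound on out-degrees by one, at the price of two paths.\<close>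

lemma balanced_as_paths:
  assumes "finite V" "A \<subseteq> V \<times> V" "asym A" "balanced A" "\<And>v. card (A `` {v}) \<le> k"
  shows "\<exists>Ps. length Ps \<le> 2 * k \<and> (\<forall>p\<in>set Ps. is_path_in V p) \<and>
    foldr sym_diff (map path_edges Ps) {} = undirected_edges A"
  using assms(2-)
proof (induction k arbitrary: A)
  case 0
  have "finite A" using 0(1) assms(1) finite_subset by blast
  then have "A `` {v} = {}" for v using 0(4)[of v] by (simp add: finite_Image)
  then have "A = {}" by auto
  then show ?case by simp
next
  case (Suc k)
  show ?case
  proof (cases "V = {}")
    case True
    then show ?thesis using Suc.prems(1) by (intro exI[of _ "[]"]) auto
  next
    case False
    have finA: "finite A" using Suc.prems(1) assms(1) finite_subset by blast
    obtain s where s: "s permutes V"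
      "\<And>v. v \<in> V \<Longrightarrow> (v, s v) \<in> A \<or> s v = v \<and> card (A `` {v}) < Suc k"
      using permutation_within_balanced[OF assms(1) Suc.prems(1,3,4)] by blast
    have asymD: "(x, y) \<in> A \<Longrightarrow> (y, x) \<notin> A" for x y
      using Suc.prems(2) by (auto simp: asym_on_def)
    have moved: "(v, s v) \<in> A" if "s v \<noteq> v" for v
      using s(2)[of v] permutes_not_in[OF s(1), of v] that by blast
    define H where "H = {(v, s v) |v. s v \<noteq> v}"
    have HA: "H \<subseteq> A" using moved by (auto simp: H_def)
    have outH: "card (H `` {v}) = of_bool (s v \<noteq> v)" for v
    proof -
      have "H `` {v} = (if s v \<noteq> v then {s v} else {})" by (auto simp: H_def)
      then show ?thesis by simp
    qed
    have inH: "card (H\<inverse> `` {v}) = of_bool (s v \<noteq> v)" for v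
    proof -
      have "H\<inverse> `` {v} = (if s v \<noteq> v then {inv s v} else {})"
        using permutes_inverses[OF s(1)] by (auto simp: H_def) metis+
      then show ?thesis by simp
    qed
    define B where "B = A - H"
    have outB: "card (B `` {v}) = card (A `` {v}) - of_bool (s v \<noteq> v)" for v
    proof -
      have "B `` {v} = A `` {v} - H `` {v}" by (auto simp: B_def)
      moreover have "H `` {v} \<subseteq> A `` {v}" using HA by blast
      ultimately show ?thesis
        using finA finite_subset[OF HA finA] outH[of v]
        by (simp add: card_Diff_subset finite_Image)
    qed
    have inB: "card (B\<inverse> `` {v}) = card (A\<inverse> `` {v}) - of_bool (s v \<noteq> v)" for v
    proof -
      have "B\<inverse> `` {v} = A\<inverse> `` {v} - H\<inverse> `` {v}" by (auto simp: B_def)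
      moreover have "H\<inverse> `` {v} \<subseteq> A\<inverse> `` {v}" using HA by blast
      ultimately show ?thesis
        using finA finite_subset[OF HA finA] inH[of v]
        by (simp add: card_Diff_subset finite_Image)
    qed
    have "\<exists>Ps. length Ps \<le> 2 * k \<and> (\<forall>p\<in>set Ps. is_path_in V p) \<and>
      foldr sym_diff (map path_edges Ps) {} = undirected_edges B"
    proof (rule Suc.IH)
      show "B \<subseteq> V \<times> V" using Suc.prems(1) by (auto simp: B_def)
      show "asym B" using asymD by (auto simp: B_def asym_on_def)
      show "balanced B" using Suc.prems(3) by (simp add: balanced_def outB inB)
      show "card (B `` {v}) \<le> k" for v
      proof (cases "s v = v \<and> v \<in> V")
        case True
        \<comment> \<open>There is no arc from \<open>v\<close> to itself, so a fixed vertex already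
          had out-degree below \<open>Suc k\<close>.\<close>
        then show ?thesis using s(2)[of v] asymD[of v v] outB[of v] by auto
      next
        case not_fixed: False
        show ?thesis
        proof (cases "v \<in> V")
          case True
          then show ?thesis using not_fixed outB[of v] Suc.prems(4)[of v] by simp
        next
          case False
          then have "A `` {v} = {}" using Suc.prems(1) by auto
          then show ?thesis using outB[of v] by simp
        qed
      qed
    qed
    then obtain Ps where Ps: "length Ps \<le> 2 * k" "\<forall>p\<in>set Ps. is_path_in V p"
      "foldr sym_diff (map path_edges Ps) {} = undirected_edges B" by blast
    \<comment> \<open>A 2-cycle would put two opposite arcs into \<open>A\<close>.\<close>
    have "s v = v" if "s (s v) = v" for v
      using moved[of v] moved[of "s v"] asymD that by metis
    then obtain p q where pq: "is_path_in V p" "is_path_in V q"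
      "undirected_edges H = sym_diff (path_edges p) (path_edges q)"
      using permutation_as_two_paths[OF cycle_decomposition[OF s(1) assms(1)] _ False]
      unfolding H_def by blast
    \<comment> \<open>Disjoint arc sets could still share an undirected edge; asymmetry excludes
      this, so the union is a symmetric difference.\<close>
    have "undirected_edges H \<inter> undirected_edges B = {}"
    proof -
      have "{x, y} \<notin> undirected_edges B" if "(x, y) \<in> H" for x y
        using that HA asymD by (auto simp: doubleton_in_undirected_edges B_def)
      then show ?thesis by (auto simp: undirected_edges_def[of H])
    qed
    moreover have "A = H \<union> B" using HA by (auto simp: B_def)
    ultimately have "undirected_edges A = sym_diff (undirected_edges H) (undirected_edges B)"
      by auto
    also have "\<dots> = foldr sym_diff (map path_edges (p # q # Ps)) {}"
      unfolding pq(3) using Ps(3) by auto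
    finally show ?thesis
      using Ps(1,2) pq(1,2) by (intro exI[of _ "p # q # Ps"]) simp
  qed
qed

theorem theorem3p1:
  fixes G :: "'a pair_pre_digraph"
  assumes "pair_graph G"
  shows "(\<exists>Ps. path_odd_cover G Ps \<and>
            real (length Ps) \<le> real (max_degree G) + real (v_odd G) / 2) \<and>
         real (p2 G) \<le> real (max_degree G) + real (v_odd G) / 2"
proof -
  interpret pair_graph G by fact
  let ?V = "pverts G" and ?E = "graph_edges G" and ?D = "max_degree G"
  have finE: "finite ?E" using pair_finite_arcs by (simp add: graph_edges_def undirected_edges_def)
  have E: "card e = 2 \<and> e \<subseteq> ?V" if "e \<in> ?E" for e
  proof -
    obtain u v where "(u, v) \<in> parcs G" "e = {u, v}"
      using \<open>e \<in> ?E\<close> by (auto simp: graph_edges_def undirected_edges_def)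
    then show ?thesis
      using pair_no_loops[of "(u, v)"] in_arcsD1[of u v] in_arcsD2[of u v] by auto
  qed
  have deg: "edge_degree ?E v = degree G v" for v
  proof -
    have "{e \<in> ?E. v \<in> e} = (\<lambda>(x, y). {x, y}) ` out_arcs G v"
    proof (intro equalityI subsetI)
      fix e assume "e \<in> {e \<in> ?E. v \<in> e}"
      then obtain x y where xy: "(x, y) \<in> parcs G" "e = {x, y}" "v = x \<or> v = y"
        by (auto simp: graph_edges_def undirected_edges_def)
      then obtain w where "(v, w) \<in> parcs G" "e = {v, w}"
        using arcs_symmetric by (metis insert_commute)
      then show "e \<in> (\<lambda>(x, y). {x, y}) ` out_arcs G v" by (force simp: out_arcs_def)
    qed (auto simp: graph_edges_def undirected_edges_def out_arcs_def)
    moreover have "inj_on (\<lambda>(x, y). {x, y}) (out_arcs G v)"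
      by (auto simp: inj_on_def out_arcs_def doubleton_eq_iff)
    ultimately show ?thesis by (simp add: edge_degree_def out_degree_def card_image)
  qed
  \<comment> \<open>\<open>odd_vertices\<close> ranges over the whole type, whereas
    \<open>v_odd\<close> and \<open>max_degree\<close> see only vertices of
    \<open>G\<close>.\<close>
  have outside: "edge_degree ?E v = 0" if "v \<notin> ?V" for v
  proof -
    have "{e \<in> ?E. v \<in> e} = {}" using that E by blast
    then show ?thesis by (simp only: edge_degree_def card.empty)
  qed
  have le_D: "edge_degree ?E v \<le> ?D" for v
    using outside[of v] pair_finite_verts
    by (cases "v \<in> ?V") (auto simp: deg max_degree_def intro: Max_ge)
  have "v \<in> ?V" if "odd (edge_degree ?E v)" for v
    using that outside[of v] by (cases "v \<in> ?V") auto
  then have "odd_vertices ?E = {v \<in> ?V. odd (degree G v)}"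
    by (auto simp: odd_vertices_def deg)
  then have odd: "card (odd_vertices ?E) = v_odd G" by (simp add: v_odd_def)
  obtain Ps F where Ps: "F \<subseteq> ?E" "odd_vertices F = {}" "2 * length Ps \<le> v_odd G"
    "\<forall>p\<in>set Ps. is_path_in ?V p" "sym_diff (foldr sym_diff (map path_edges Ps) {}) F = ?E"
    using even_subgraph_modulo_paths[OF finE E] unfolding odd by blast
  have finF: "finite F" using Ps(1) finE finite_subset by blast
  then obtain A where A: "finite A" "asym A" "balanced A" "undirected_edges A = F"
    using balanced_orientation[of F] Ps(1,2) E by blast
  have "A \<subseteq> ?V \<times> ?V"
  proof
    fix a assume "a \<in> A"
    then have "{fst a, snd a} \<in> F" using A(4) by (force simp: undirected_edges_def)
    then show "a \<in> ?V \<times> ?V" using Ps(1) E by (cases a) fastforce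
  qed
  moreover have "card (A `` {v}) \<le> ?D div 2" for v
  proof -
    have "2 * card (A `` {v}) = edge_degree F v"
      using edge_degree_undirected_edges[OF A(1,2), of v] A(3,4) by (simp add: balanced_def)
    also have "\<dots> \<le> ?D" using edge_degree_mono[OF finE Ps(1)] le_D order_trans by blast
    finally show ?thesis by simp
  qed
  ultimately obtain Qs where Qs: "length Qs \<le> 2 * (?D div 2)" "\<forall>p\<in>set Qs. is_path_in ?V p"
    "foldr sym_diff (map path_edges Qs) {} = F"
    using balanced_as_paths[OF pair_finite_verts _ A(2,3), of "?D div 2"] A(4) by blast
  have cover: "path_odd_cover G (Ps @ Qs)"
    using Ps(4,5) Qs(2,3)
    by (auto simp: path_odd_cover_def vpath_complete_graph_on_iff foldr_sym_diff_append
        simp del: foldr_append)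
  \<comment> \<open>Rounding down is legitimate because out-degrees are integers with twice their
    value at most \<open>?D\<close>.\<close>
  have "2 * (?D div 2) \<le> ?D" by simp
  then have bound: "2 * length (Ps @ Qs) \<le> 2 * ?D + v_odd G"
    using Ps(3) Qs(1) by simp
  then have len: "real (length (Ps @ Qs)) \<le> real ?D + real (v_odd G) / 2" by linarith
  have "p2 G \<le> length (Ps @ Qs)"
    unfolding p2_def using cover by (intro Least_le) blast
  then have "real (p2 G) \<le> real ?D + real (v_odd G) / 2" using len by linarith
  then show ?thesis using cover len by blast
qed

end
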